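(* Let $t=2$. For every rate $0<R<1-H(0.25)$ there exists an MD-achievable fingerprinting code under the marking assumption; that is, there exists a sequence (indexed by the code length $n$) of randomized binary fingerprinting codes $(F,G)$ with $M=\lfloor2^{nR}\rfloor$ users and minimum distance (MD) decoding such that $\overline{P}_m(F,G)\to0$ exponentially fast as $n\to\infty$.
   Context: $H(p)=-p\log_2p-(1-p)\log_2(1-p)$ is the binary entropy function. Randomized fingerprinting code $(F,G)$: a finite collection of pairs of maps $f_k:\{1,\dots,M\}\to\{0,1\}^n$ (encoders) and $g_k:\{0,1\}^n\to\{1,\dots,M\}$ (decoders), $k=1,\dots,K$, together with a probability distribution $p(k)$ on the secret key $k$. The key is known to the distributor (decoder) but not to the users; the family and $p$ are known to everybody. MD decoding: $g_k(\mathbf{y})$ is a user $u$ for which the Hamming distance $d_H(\mathbf{y},f_k(u))$ is minimal. Marking assumption ($t=2$): for a coalition $U=\{u_1,u_2\}$ of two distinct users with fingerprints $\mathbf{x}_1=f_k(u_1),\mathbf{x}_2=f_k(u_2)$, position $i$ is undetectable if $x_{1i}=x_{2i}$. The set of possible forged copies is $E(U)=\{\mathbf{y}\in\{0,1\}^n: y_i=x_{1i}\text{ for every undetectable } i\}$. A strategy is a conditional distribution $V(\mathbf{y}\mid\mathbf{x}_1,\mathbf{x}_2)$ with $V(\mathbf{y}\mid\mathbf{x}_1,\mathbf{x}_2)=0$ for all $\mathbf{y}\notin E(U)$; $\mathcal{V}$ is the set of all such strategies. Misidentification probability: $$P_m(U,F,G,V)=\mathbb{E}_k\Big(\sum_{\mathbf{y}\in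 E(U),\,g_k(\mathbf{y})\notin U}V(\mathbf{y}\mid f_k(U))\Big),\qquad \overline{P}_m(F,G)=\frac{1}{\binom{M}{2}}\sum_{U}\max_{V\in\mathcal{V}}P_m(U,F,G,V),$$ where $f_k(U)=(f_k(u_1),f_k(u_2))$, the expectation is over the key, and the outer sum is over all coalitions of size $2$. In the paper's terminology, MD-achievable means that the misidentification probability under MD decoding, averaged over the (secret) random choice of the codebook, goes exponentially to zero as $n\to\infty$. *)

theory Defs
  imports "HOL-Probability.Probability" "HOL-Library.Landau_Symbols"
begin

definition binary_entropy :: "real \<Rightarrow> real" where
  "binary_entropy p = - p * log 2 p - (1 - p) * log 2 (1 - p)"

type_synonym word = "bool list"

definition words :: "nat \<Rightarrow> word set" where
  "words n = {x. length x = n}"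

definition hamming_dist :: "nat \<Rightarrow> word \<Rightarrow> word \<Rightarrow> nat" where
  "hamming_dist n x y = card {i. i < n \<and> x ! i \<noteq> y ! i}"

record fp_code =
  num_keys :: nat
  key_dist :: "nat pmf"
  enc :: "nat \<Rightarrow> nat \<Rightarrow> word"
  dec :: "nat \<Rightarrow> word \<Rightarrow> nat"

text \<open>
  Keys range over \<open>{1..num_keys C}\<close> and users over \<open>{1..M}\<close>. The maps \<open>enc C k\<close> and
  \<open>dec C k\<close> are only constrained on their intended domains; all notions below use them only there.
\<close>

definition fingerprinting_code :: "nat \<Rightarrow> nat \<Rightarrow> fp_code \<Rightarrow> bool" where
  "fingerprinting_code n M C \<longleftrightarrow>
     set_pmf (key_dist C) \<subseteq> {1..num_keys C} \<and>
     (\<forall>k\<in>{1..num_keys C}. enc C k \<in> {1..M} \<rightarrow> words n \<and> dec C k \<in> words n \<rightarrow> {1..M})"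

text \<open>Ties may be broken arbitrarily.\<close>

definition MD_decoding :: "nat \<Rightarrow> nat \<Rightarrow> fp_code \<Rightarrow> bool" where
  "MD_decoding n M C \<longleftrightarrow>
     (\<forall>k\<in>{1..num_keys C}. \<forall>y\<in>words n. dec C k y \<in> {1..M} \<and>
        (\<forall>u\<in>{1..M}. hamming_dist n y (enc C k (dec C k y)) \<le> hamming_dist n y (enc C k u)))"

definition envelope :: "nat \<Rightarrow> word \<Rightarrow> word \<Rightarrow> word set" where
  "envelope n x1 x2 = {y \<in> words n. \<forall>i<n. x1 ! i = x2 ! i \<longrightarrow> y ! i = x1 ! i}"

text \<open>A strategy sees the two fingerprints only, neither the key nor the users' identities.\<close>

definition strategies :: "nat \<Rightarrow> (word \<Rightarrow> word \<Rightarrow> word pmf) set" where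
  "strategies n = {V. \<forall>x1\<in>words n. \<forall>x2\<in>words n. set_pmf (V x1 x2) \<subseteq> envelope n x1 x2}"

definition coalitions :: "nat \<Rightarrow> nat set set" where
  "coalitions M = {U. U \<subseteq> {1..M} \<and> card U = 2}"

text \<open>
  The members of a coalition \<open>U\<close> are listed in increasing order, \<open>u1 = Min U\<close> and \<open>u2 = Max U\<close>.
  The order is immaterial once the maximum over all strategies is taken, as \<open>strategies n\<close> is
  closed under exchanging the two arguments.
\<close>

definition misid_prob ::
  "nat \<Rightarrow> nat set \<Rightarrow> fp_code \<Rightarrow> (word \<Rightarrow> word \<Rightarrow> word pmf) \<Rightarrow> real" where
  "misid_prob n U C V = measure_pmf.expectation (key_dist C) (\<lambda>k.
     let x1 = enc C k (Min U); x2 = enc C k (Max U)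
     in \<Sum>y | y \<in> envelope n x1 x2 \<and> dec C k y \<notin> U. pmf (V x1 x2) y)"

text \<open>
  For a code of length \<open>n\<close> the supremum is a maximum: \<open>misid_prob n U C V\<close> lies in \<open>[0, 1]\<close> and is
  linear in the finitely many probabilities of \<open>V\<close> on words of length \<open>n\<close>, so it is maximized by
  a deterministic strategy. If \<open>M < 2\<close> there are no coalitions and the average is \<open>0 / 0 = 0\<close>.
\<close>

definition avg_misid_prob :: "nat \<Rightarrow> nat \<Rightarrow> fp_code \<Rightarrow> real" where
  "avg_misid_prob n M C =
     1 / real (M choose 2) * (\<Sum>U\<in>coalitions M. SUP V\<in>strategies n. misid_prob n U C V)"

end

theory Submission
  imports Defs
begin

text \<open>
  Take the codebook uniformly at random among all maps from users to words. Every forgery \<open>y\<close> in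
  the envelope satisfies \<open>d(y, x1) + d(y, x2) = d(x1, x2) =: D\<close>, so an innocent user \<open>w\<close> can only
  be accused if \<open>d(y, x_w) \<le> D/2\<close>. Given \<open>x1\<close> and \<open>x2\<close>, the forgery is independent of \<open>x_w\<close>, so this
  happens for some \<open>w\<close> with probability at most \<open>min 1 (M Vol(D/2) / 2^n)\<close>, and
  \<open>Vol(D/2) \<le> 3^(D/2) (4/3)^n\<close>. Bounding \<open>min 1 x\<close> by \<open>x^\<rho>\<close> with \<open>\<rho> \<in> (0, 1]\<close> and averaging over the
  binomially distributed \<open>D\<close> gives the bound \<open>\<theta>^n\<close> with
  \<open>\<theta> = (2^R 2/3)^\<rho> (1 + 3^(\<rho>/2)) / 2\<close>, which is below 1 for small \<open>\<rho>\<close> when \<open>R < 1 - H(1/4)\<close>.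
\<close>

section \<open>Hamming geometry of binary words\<close>

lemma words_Suc: "words (Suc n) = Cons True ` words n \<union> Cons False ` words n"
  by (auto simp: words_def length_Suc_conv image_iff)

lemma finite_words [simp]: "finite (words n)"
  using finite_lists_length_eq[of "UNIV :: bool set" n] by (simp add: words_def)

lemma card_words: "card (words n) = 2 ^ n"
  using card_lists_length_eq[of "UNIV :: bool set" n] by (simp add: words_def)

lemma hamming_dist_Cons:
  "hamming_dist (Suc n) (b # x) (c # y) = of_bool (b \<noteq> c) + hamming_dist n x y"
proof -
  have "{i. i < Suc n \<and> (b # x) ! i \<noteq> (c # y) ! i} =
      (if b \<noteq> c then {0} else {}) \<union> Suc ` {i. i < n \<and> x ! i \<noteq> y ! i}"
    by (auto simp: less_Suc_eq_0_disj)
  then show ?thesis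
    by (simp add: hamming_dist_def card_image)
qed

text \<open>Each coordinate contributes 1 for agreement and \<open>a\<close> for disagreement,
  independently of the others. Used with \<open>a = 1/3\<close> for ball volumes and with
  \<open>a = 3 powr (r / 2)\<close> for the average over coalition fingerprints.\<close>

lemma hamming_dist_weight_enumerator:
  fixes a :: real
  assumes "y \<in> words n"
  shows "(\<Sum>x\<in>words n. a ^ hamming_dist n y x) = (1 + a) ^ n"
  using assms
proof (induction n arbitrary: y)
  case 0
  then show ?case by (simp add: words_def hamming_dist_def)
next
  case (Suc n)
  then obtain b z where y: "y = b # z" "z \<in> words n"
    by (auto simp: words_def length_Suc_conv)
  have "(\<Sum>x\<in>words (Suc n). a ^ hamming_dist (Suc n) y x) =
      (\<Sum>x\<in>Cons True ` words n. a ^ hamming_dist (Suc n) y x) +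
      (\<Sum>x\<in>Cons False ` words n. a ^ hamming_dist (Suc n) y x)"
    unfolding words_Suc by (rule sum.union_disjoint) auto
  also have "\<dots> = (\<Sum>x\<in>words n. a ^ (of_bool (b \<noteq> True) + hamming_dist n z x)) +
      (\<Sum>x\<in>words n. a ^ (of_bool (b \<noteq> False) + hamming_dist n z x))"
    by (simp add: sum.reindex hamming_dist_Cons y)
  also have "\<dots> = (1 + a) * (\<Sum>x\<in>words n. a ^ hamming_dist n z x)"
    by (cases b) (simp_all add: sum_distrib_left [symmetric] algebra_simps)
  finally show ?case
    using Suc.IH[OF y(2)] by simp
qed

text \<open>Chernoff bound with tilting parameter 1/3, which is optimal for relative radius 1/4.\<close>

lemma card_hamming_ball_le:
  assumes "y \<in> words n"
  shows "real (card {x \<in> words n. 2 * hamming_dist n y x \<le> D}) \<le> 3 powr (D / 2) * (4 / 3) ^ n"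
proof -
  have "real (card {x \<in> words n. 2 * hamming_dist n y x \<le> D}) =
      (\<Sum>x | x \<in> words n \<and> 2 * hamming_dist n y x \<le> D. 1)"
    by simp
  also have "\<dots> \<le> (\<Sum>x | x \<in> words n \<and> 2 * hamming_dist n y x \<le> D.
      3 powr (D / 2) * (1 / 3) ^ hamming_dist n y x)"
  proof (rule sum_mono)
    fix x assume "x \<in> {x \<in> words n. 2 * hamming_dist n y x \<le> D}"
    then have "real (hamming_dist n y x) \<le> real D / 2" by simp
    then have "(3::real) powr (hamming_dist n y x) \<le> 3 powr (D / 2)"
      by (intro powr_mono) auto
    then show "(1::real) \<le> 3 powr (D / 2) * (1 / 3) ^ hamming_dist n y x"
      by (simp add: powr_realpow power_one_over field_simps)
  qed
  also have "\<dots> \<le> (\<Sum>x\<in>words n. 3 powr (D / 2) * (1 / 3) ^ hamming_dist n y x)"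
    by (rule sum_mono2) auto
  also have "\<dots> = 3 powr (D / 2) * (4 / 3) ^ n"
    using hamming_dist_weight_enumerator[OF assms, of "1/3"]
    by (simp add: sum_distrib_left [symmetric])
  finally show ?thesis .
qed

text \<open>Where \<open>x1\<close> and \<open>x2\<close> agree, \<open>y\<close> agrees with both;
  where they differ, a bit of \<open>y\<close> must match exactly one of them. So every detectable
  position is counted once.\<close>

lemma hamming_dist_envelope:
  assumes "y \<in> envelope n x1 x2"
  shows "hamming_dist n y x1 + hamming_dist n y x2 = hamming_dist n x1 x2"
proof -
  have eq: "{i. i < n \<and> x1 ! i \<noteq> x2 ! i} =
      {i. i < n \<and> y ! i \<noteq> x1 ! i} \<union> {i. i < n \<and> y ! i \<noteq> x2 ! i}"
    using assms by (auto simp: envelope_def)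
  show ?thesis
    unfolding hamming_dist_def eq
    by (rule card_Un_disjoint [symmetric]) (use assms in \<open>auto simp: envelope_def\<close>)
qed

section \<open>Counting codebooks with prescribed fingerprints\<close>

text \<open>For finite nonempty \<open>W\<close> this is independence of the values of a uniformly
  random map at three distinct points, with denominators cleared to stay in the natural
  numbers.\<close>

lemma card_PiE_three_constraints:
  assumes "finite I" "u \<in> I" "v \<in> I" "w \<in> I" "u \<noteq> v" "w \<noteq> u" "w \<noteq> v"
    and "a \<in> W" "b \<in> W" "S \<subseteq> W"
  shows "card {f \<in> I \<rightarrow>\<^sub>E W. f u = a \<and> f v = b \<and> f w \<in> S} * card W ^ 3 =
    card (I \<rightarrow>\<^sub>E W) * card S"
proof -
  define J where "J = I - {u, v, w}"
  have I: "I = insert u (insert v (insert w J))" "finite J" "u \<notin> J" "v \<notin> J" "w \<notin> J"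
    using assms by (auto simp: J_def)
  \<comment> \<open>Each constraint concerns a single coordinate, so the constrained maps again form
    a product and can be counted factor by factor.\<close>
  define B where "B i = (if i = u then {a} else if i = v then {b} else if i = w then S else W)" for i
  have "{f \<in> I \<rightarrow>\<^sub>E W. f u = a \<and> f v = b \<and> f w \<in> S} = Pi\<^sub>E I B"
  proof (intro equalityI subsetI)
    fix f assume f: "f \<in> Pi\<^sub>E I B"
    then have "f u \<in> B u" "f v \<in> B v" "f w \<in> B w"
      using assms(2-4) by (auto simp: PiE_iff)
    moreover have "B i \<subseteq> W" for i
      using assms by (auto simp: B_def)
    ultimately show "f \<in> {f \<in> I \<rightarrow>\<^sub>E W. f u = a \<and> f v = b \<and> f w \<in> S}"
      using assms(5-7) PiE_mono[of I B "\<lambda>_. W"] f by (auto simp: B_def)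
  qed (use assms in \<open>auto simp: PiE_iff B_def\<close>)
  then have "card {f \<in> I \<rightarrow>\<^sub>E W. f u = a \<and> f v = b \<and> f w \<in> S} = (\<Prod>i\<in>I. card (B i))"
    using assms(1) by (simp add: card_PiE)
  also have "\<dots> = card S * (\<Prod>i\<in>J. card (B i))"
    using I assms(5-7) by (auto simp: B_def)
  also have "(\<Prod>i\<in>J. card (B i)) = (\<Prod>i\<in>J. card W)"
    using I by (intro prod.cong) (auto simp: B_def)
  finally show ?thesis
    using I assms(1,5-7) by (simp add: card_PiE power3_eq_cube)
qed

lemma card_PiE_two_constraints:
  assumes "finite I" "u \<in> I" "v \<in> I" "u \<noteq> v" "a \<in> W" "b \<in> W"
  shows "card {f \<in> I \<rightarrow>\<^sub>E W. f u = a \<and> f v = b} * card W ^ 2 = card (I \<rightarrow>\<^sub>E W)"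
proof -
  define J where "J = I - {u, v}"
  have I: "I = insert u (insert v J)" "finite J" "u \<notin> J" "v \<notin> J"
    using assms by (auto simp: J_def)
  define B where "B i = (if i = u then {a} else if i = v then {b} else W)" for i
  have "{f \<in> I \<rightarrow>\<^sub>E W. f u = a \<and> f v = b} = Pi\<^sub>E I B"
  proof (intro equalityI subsetI)
    fix f assume f: "f \<in> Pi\<^sub>E I B"
    then have "f u \<in> B u" "f v \<in> B v"
      using assms(2,3) by (auto simp: PiE_iff)
    moreover have "B i \<subseteq> W" for i
      using assms by (auto simp: B_def)
    ultimately show "f \<in> {f \<in> I \<rightarrow>\<^sub>E W. f u = a \<and> f v = b}"
      using assms(4) PiE_mono[of I B "\<lambda>_. W"] f by (auto simp: B_def)
  qed (use assms in \<open>auto simp: PiE_iff B_def\<close>)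
  then have "card {f \<in> I \<rightarrow>\<^sub>E W. f u = a \<and> f v = b} = (\<Prod>i\<in>I. card (B i))"
    using assms(1) by (simp add: card_PiE)
  also have "\<dots> = (\<Prod>i\<in>J. card (B i))"
    using I assms(4) by (auto simp: B_def)
  also have "\<dots> = (\<Prod>i\<in>J. card W)"
    using I by (intro prod.cong) (auto simp: B_def)
  finally show ?thesis
    using I assms(1,4) by (simp add: card_PiE power2_eq_square)
qed

section \<open>The random code\<close>

text \<open>Extensionality fixes the values outside \<open>{1..M}\<close>, leaving a finite set that
  can carry a uniform distribution.\<close>

definition codebooks :: "nat \<Rightarrow> nat \<Rightarrow> (nat \<Rightarrow> word) set" where
  "codebooks n M = {1..M} \<rightarrow>\<^sub>E words n"

text \<open>An arbitrary numbering, since keys are numbers. Under a uniform key the fingerprints of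
  distinct users are independent and uniform on \<open>words n\<close>.\<close>

definition codebook :: "nat \<Rightarrow> nat \<Rightarrow> nat \<Rightarrow> nat \<Rightarrow> word" where
  "codebook n M = (SOME b. bij_betw b {1..card (codebooks n M)} (codebooks n M))"

definition random_code :: "nat \<Rightarrow> nat \<Rightarrow> fp_code" where
  "random_code n M =
    \<lparr>num_keys = card (codebooks n M),
     key_dist = pmf_of_set {1..card (codebooks n M)},
     enc = codebook n M,
     dec = (\<lambda>k y. arg_min (\<lambda>u. hamming_dist n y (codebook n M k u)) (\<lambda>u. u \<in> {1..M}))\<rparr>"

lemma finite_codebooks [simp]: "finite (codebooks n M)"
  by (simp add: codebooks_def finite_PiE)

lemma card_codebooks_pos: "card (codebooks n M) > 0"
  by (simp add: codebooks_def card_PiE card_words)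

lemma bij_betw_codebook: "bij_betw (codebook n M) {1..card (codebooks n M)} (codebooks n M)"
proof -
  have "\<exists>b. bij_betw b {1..card (codebooks n M)} (codebooks n M)"
    by (rule ex_bij_betw_nat_finite_1) simp
  from someI_ex[OF this] show ?thesis
    unfolding codebook_def .
qed

lemma
  assumes "M \<ge> 1"
  shows fingerprinting_random_code: "fingerprinting_code n M (random_code n M)"
    and MD_decoding_random_code: "MD_decoding n M (random_code n M)"
proof -
  \<comment> \<open>User 1 witnesses that there is a user at all, so \<open>arg_min\<close> attains
    its minimum.\<close>
  have dec: "dec (random_code n M) k y \<in> {1..M} \<and> (\<forall>u\<in>{1..M}.
      hamming_dist n y (codebook n M k (dec (random_code n M) k y))
        \<le> hamming_dist n y (codebook n M k u))" for k y
    using arg_min_nat_lemma[of "\<lambda>u. u \<in> {1..M}" 1 "\<lambda>u. hamming_dist n y (codebook n M k u)"] assms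
    unfolding random_code_def by simp
  then show "MD_decoding n M (random_code n M)"
    by (simp add: MD_decoding_def random_code_def)
  have "codebook n M k \<in> codebooks n M" if "k \<in> {1..card (codebooks n M)}" for k
    using bij_betw_codebook that by (rule bij_betw_apply)
  moreover have "set_pmf (pmf_of_set {1..card (codebooks n M)}) = {1..card (codebooks n M)}"
    using card_codebooks_pos[of n M] by (intro set_pmf_of_set) auto
  ultimately show "fingerprinting_code n M (random_code n M)"
    using dec by (fastforce simp: fingerprinting_code_def random_code_def codebooks_def PiE_def)
qed

section \<open>Error bound for a fixed coalition\<close>

text \<open>Relative to all codebooks, \<open>1 / 2 ^ (2 * n)\<close> is the probability of the pair
  \<open>x1\<close>, \<open>x2\<close>, and the minimum bounds the conditional probability that an
  innocent user comes within \<open>D / 2\<close> of the fixed word \<open>y\<close>.\<close>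

lemma card_confusable_codebooks_le:
  fixes n M x1 x2 D
  defines "T \<equiv> 3 powr (real D / 2) * (4 / 3) ^ n :: real"
  assumes "u \<in> {1..M}" "v \<in> {1..M}" "u \<noteq> v" "x1 \<in> words n" "x2 \<in> words n" "y \<in> words n"
  shows "real (card {f \<in> codebooks n M. f u = x1 \<and> f v = x2 \<and>
      (\<exists>w\<in>{1..M} - {u, v}. 2 * hamming_dist n y (f w) \<le> D)})
    \<le> card (codebooks n M) / 2 ^ (2 * n) * min 1 (M * T / 2 ^ n)"
    (is "real (card ?A) \<le> _")
proof -
  let ?K = "real (card (codebooks n M))"
  let ?S = "{x \<in> words n. 2 * hamming_dist n y x \<le> D}"
  \<comment> \<open>Forgetting the innocent users gives the alternative 1 in the minimum.\<close>
  have "real (card ?A) \<le> card {f \<in> codebooks n M. f u = x1 \<and> f v = x2}"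
    by (intro of_nat_mono card_mono) auto
  moreover have "real (card {f \<in> codebooks n M. f u = x1 \<and> f v = x2} * (2 ^ n) ^ 2) = ?K"
    using card_PiE_two_constraints[of "{1..M}" u v x1 "words n" x2] assms
    by (simp only: codebooks_def card_words) simp
  then have "real (card {f \<in> codebooks n M. f u = x1 \<and> f v = x2}) = ?K / 2 ^ (2 * n)"
    by (simp add: field_simps power_mult [symmetric] mult.commute)
  ultimately have 1: "real (card ?A) \<le> ?K / 2 ^ (2 * n)"
    by simp
  \<comment> \<open>The other alternative is a union bound over the innocent users, each of whom
    falls into the ball \<open>?S\<close> with probability \<open>card ?S / 2 ^ n\<close>.\<close>
  have "?A = (\<Union>w\<in>{1..M} - {u, v}. {f \<in> codebooks n M. f u = x1 \<and> f v = x2 \<and> f w \<in> ?S})"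
    using assms by (auto simp: codebooks_def PiE_iff)
  then have "card ?A \<le> (\<Sum>w\<in>{1..M} - {u, v}.
      card {f \<in> codebooks n M. f u = x1 \<and> f v = x2 \<and> f w \<in> ?S})"
    by (simp only:) (rule card_UN_le, simp)
  then have "real (card ?A) \<le> (\<Sum>w\<in>{1..M} - {u, v}.
      real (card {f \<in> codebooks n M. f u = x1 \<and> f v = x2 \<and> f w \<in> ?S}))"
    unfolding of_nat_sum [symmetric] by (rule of_nat_mono)
  also have "\<dots> = (\<Sum>w\<in>{1..M} - {u, v}. ?K * card ?S / 2 ^ (3 * n))"
  proof (rule sum.cong)
    fix w assume "w \<in> {1..M} - {u, v}"
    then have "card {f \<in> codebooks n M. f u = x1 \<and> f v = x2 \<and> f w \<in> ?S} * (2 ^ n) ^ 3 =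
        card (codebooks n M) * card ?S"
      using card_PiE_three_constraints[of "{1..M}" u v w x1 "words n" x2 ?S] assms
      by (simp only: codebooks_def card_words) auto
    then have "real (card {f \<in> codebooks n M. f u = x1 \<and> f v = x2 \<and> f w \<in> ?S} * (2 ^ n) ^ 3) =
        ?K * card ?S"
      by (simp only: of_nat_mult)
    then show "real (card {f \<in> codebooks n M. f u = x1 \<and> f v = x2 \<and> f w \<in> ?S}) =
        ?K * card ?S / 2 ^ (3 * n)"
      by (simp add: field_simps power_mult [symmetric] mult.commute)
  qed simp
  also have "\<dots> = card ({1..M} - {u, v}) * (?K * card ?S / 2 ^ (3 * n))"
    by simp
  also have "\<dots> \<le> M * (?K * T / 2 ^ (3 * n))"
    using card_mono[of "{1..M}" "{1..M} - {u, v}"] card_hamming_ball_le[OF \<open>y \<in> words n\<close>, of D]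
    by (intro mult_mono divide_right_mono mult_left_mono) (auto simp: T_def)
  also have "\<dots> = ?K / 2 ^ (2 * n) * (M * T / 2 ^ n)"
    by (simp add: field_simps power_add [symmetric])
  finally show ?thesis
    using 1 by (simp only: min_def mult_1_right split: if_split) blast
qed

text \<open>The conditional error bound is averaged over two independent uniform guilty
  fingerprints. As it involves neither \<open>U\<close> nor \<open>V\<close>, it survives the
  supremum over strategies and the average over coalitions.\<close>

lemma misid_prob_random_code_le:
  assumes U: "U \<in> coalitions M" and V: "V \<in> strategies n"
  shows "misid_prob n U (random_code n M) V \<le> (\<Sum>x1\<in>words n. \<Sum>x2\<in>words n.
    min 1 (M * (3 powr (hamming_dist n x1 x2 / 2) * (4 / 3) ^ n) / 2 ^ n)) / 2 ^ (2 * n)"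
proof -
  define u v where "u = Min U" and "v = Max U"
  have finU: "finite U" "card U = 2" "U \<subseteq> {1..M}"
    using U by (auto simp: coalitions_def intro: card_ge_0_finite)
  then obtain p q where pq: "U = {p, q}" "p \<noteq> q"
    by (auto simp: card_2_iff)
  have Uuv: "U = {u, v}" "u \<noteq> v"
    using pq by (auto simp: u_def v_def min_def max_def)
  have uv: "u \<in> {1..M}" "v \<in> {1..M}" and "M \<ge> 1"
    using Uuv finU by auto
  let ?K = "card (codebooks n M)"
  \<comment> \<open>This event contains every false accusation, however ties are broken, and does
    not mention the decoder.\<close>
  define bad where "bad f y \<longleftrightarrow> (\<exists>w\<in>{1..M} - {u, v}.
      2 * hamming_dist n y (f w) \<le> hamming_dist n (f u) (f v))" for f :: "nat \<Rightarrow> word" and y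
  define G where "G f = (\<Sum>y\<in>words n. pmf (V (f u) (f v)) y * of_bool (bad f y))" for f
  let ?T = "\<lambda>x1 x2. min 1 (M * (3 powr (hamming_dist n x1 x2 / 2) * (4 / 3) ^ n) / 2 ^ n :: real)"

  have step: "(\<Sum>y | y \<in> envelope n (f u) (f v) \<and> dec (random_code n M) k y \<notin> U.
      pmf (V (f u) (f v)) y) \<le> G f"
    if k: "k \<in> {1..?K}" and f: "f = codebook n M k" for k f
  proof -
    have "bad f y" if y: "y \<in> envelope n (f u) (f v)" "dec (random_code n M) k y \<notin> U" for y
    proof -
      let ?w = "dec (random_code n M) k y"
      have "y \<in> words n" using y by (auto simp: envelope_def)
      then have w: "?w \<in> {1..M}"
        "\<forall>t\<in>{1..M}. hamming_dist n y (f ?w) \<le> hamming_dist n y (f t)"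
        using MD_decoding_random_code[OF \<open>M \<ge> 1\<close>, of n] k
        unfolding MD_decoding_def f by (auto simp: random_code_def)
      then have "hamming_dist n y (f ?w) \<le> hamming_dist n y (f u)"
        "hamming_dist n y (f ?w) \<le> hamming_dist n y (f v)"
        using uv by auto
      \<comment> \<open>The sum of the distances to both guilty users is constant on the envelope,
        so adding the two inequalities suffices.\<close>
      then have "2 * hamming_dist n y (f ?w) \<le> hamming_dist n (f u) (f v)"
        using hamming_dist_envelope[OF y(1)] by simp
      then show ?thesis
        using w(1) y(2) Uuv unfolding bad_def by blast
    qed
    then have "(\<Sum>y | y \<in> envelope n (f u) (f v) \<and> dec (random_code n M) k y \<notin> U.
        pmf (V (f u) (f v)) y) =
      (\<Sum>y | y \<in> envelope n (f u) (f v) \<and> dec (random_code n M) k y \<notin> U.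
        pmf (V (f u) (f v)) y * of_bool (bad f y))"
      by (intro sum.cong) auto
    \<comment> \<open>With the indicator in place the range can grow to all words; it then no longer
      depends on the codebook, which permits exchanging sums.\<close>
    also have "\<dots> \<le> G f"
      unfolding G_def by (rule sum_mono2) (auto simp: envelope_def)
    finally show ?thesis .
  qed

  \<comment> \<open>Fixing both guilty fingerprints fixes the law of the forgery, so codebooks can
    be counted for each \<open>y\<close> separately.\<close>
  have fibre: "(\<Sum>f | f \<in> codebooks n M \<and> (f u, f v) = (x1, x2). G f)
      \<le> ?K / 2 ^ (2 * n) * ?T x1 x2"
    if x: "x1 \<in> words n" "x2 \<in> words n" for x1 x2
  proof -
    let ?F = "{f. f \<in> codebooks n M \<and> (f u, f v) = (x1, x2)}"
    have "(\<Sum>f\<in>?F. G f) = (\<Sum>f\<in>?F. \<Sum>y\<in>words n. pmf (V x1 x2) y * of_bool (bad f y))"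
      unfolding G_def by (intro sum.cong) auto
    also have "\<dots> = (\<Sum>y\<in>words n. pmf (V x1 x2) y * (\<Sum>f\<in>?F. of_bool (bad f y)))"
      by (subst sum.swap) (simp only: sum_distrib_left)
    also have "\<dots> \<le> (\<Sum>y\<in>words n. pmf (V x1 x2) y * (?K / 2 ^ (2 * n) * ?T x1 x2))"
    proof (intro sum_mono mult_left_mono)
      fix y assume y: "y \<in> words n"
      have "(\<Sum>f\<in>?F. of_bool (bad f y) :: real) = card (?F \<inter> {f. bad f y})"
        by (simp add: sum_of_bool_eq)
      also have "?F \<inter> {f. bad f y} = {f \<in> codebooks n M. f u = x1 \<and> f v = x2 \<and>
          (\<exists>w\<in>{1..M} - {u, v}. 2 * hamming_dist n y (f w) \<le> hamming_dist n x1 x2)}"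
        by (auto simp: bad_def)
      also have "real (card \<dots>) \<le> ?K / 2 ^ (2 * n) * ?T x1 x2"
        using uv Uuv(2) x y by (rule card_confusable_codebooks_le)
      finally show "(\<Sum>f\<in>?F. of_bool (bad f y)) \<le> ?K / 2 ^ (2 * n) * ?T x1 x2" .
    qed simp
    \<comment> \<open>Here the strategy drops out: its total mass is at most 1.\<close>
    also have "\<dots> = measure (measure_pmf (V x1 x2)) (words n) * (?K / 2 ^ (2 * n) * ?T x1 x2)"
      by (simp only: measure_measure_pmf_finite finite_words sum_distrib_right)
    also have "\<dots> \<le> 1 * (?K / 2 ^ (2 * n) * ?T x1 x2)"
      by (intro mult_right_mono) auto
    finally show ?thesis by simp
  qed

  have "(\<Sum>k\<in>{1..?K}. G (codebook n M k)) = (\<Sum>f\<in>codebooks n M. G f)"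
    using bij_betw_codebook by (rule sum.reindex_bij_betw)
  also have "\<dots> = (\<Sum>p\<in>words n \<times> words n. \<Sum>f | f \<in> codebooks n M \<and> (f u, f v) = p. G f)"
    using uv by (intro sum.group [symmetric] finite_codebooks finite_SigmaI finite_words)
      (auto simp: codebooks_def)
  also have "\<dots> = (\<Sum>x1\<in>words n. \<Sum>x2\<in>words n.
      \<Sum>f | f \<in> codebooks n M \<and> (f u, f v) = (x1, x2). G f)"
    unfolding sum.cartesian_product by (intro sum.cong) auto
  also have "\<dots> \<le> (\<Sum>x1\<in>words n. \<Sum>x2\<in>words n. ?K / 2 ^ (2 * n) * ?T x1 x2)"
    by (intro sum_mono fibre)
  also have "\<dots> = ?K / 2 ^ (2 * n) * (\<Sum>x1\<in>words n. \<Sum>x2\<in>words n. ?T x1 x2)"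
    unfolding sum_distrib_left ..
  finally have total: "(\<Sum>k\<in>{1..?K}. G (codebook n M k)) \<le> \<dots>" .

  have "misid_prob n U (random_code n M) V = (\<Sum>k\<in>{1..?K}.
      \<Sum>y | y \<in> envelope n (codebook n M k u) (codebook n M k v) \<and> dec (random_code n M) k y \<notin> U.
        pmf (V (codebook n M k u) (codebook n M k v)) y) / ?K"
    using card_codebooks_pos[of n M] unfolding misid_prob_def Let_def u_def v_def
    by (subst (1) random_code_def) (simp add: integral_pmf_of_set random_code_def)
  also have "\<dots> \<le> (\<Sum>k\<in>{1..?K}. G (codebook n M k)) / ?K"
    by (intro divide_right_mono sum_mono step) auto
  also have "\<dots> \<le> (?K / 2 ^ (2 * n) * (\<Sum>x1\<in>words n. \<Sum>x2\<in>words n. ?T x1 x2)) / ?K"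
    using total by (rule divide_right_mono) simp
  also have "\<dots> = (\<Sum>x1\<in>words n. \<Sum>x2\<in>words n. ?T x1 x2) / 2 ^ (2 * n)"
    using card_codebooks_pos[of n M] by (simp del: card_gt_0_iff card_0_eq)
  finally show ?thesis .
qed

section \<open>Averaging and the exponent\<close>

lemma misid_prob_nonneg: "0 \<le> misid_prob n U C V"
  unfolding misid_prob_def Let_def 
  by (intro Bochner_Integration.integral_nonneg sum_nonneg) auto

text \<open>Gallager's device: unlike the minimum, a power factors over coordinates, so the average
  over words can be evaluated exactly.\<close>

lemma min_one_le_powr:
  fixes x r :: real
  assumes "0 \<le> x" "0 < r" "r \<le> 1"
  shows "min 1 x \<le> x powr r"
proof (cases "x \<le> 1")
  case True
  then have "x powr 1 \<le> x powr r"
    using assms by (intro powr_mono') auto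
  then show ?thesis using True assms by simp
next
  case False
  then show ?thesis using assms by (simp add: ge_one_powr_ge_zero)
qed

text \<open>The power turns the summand into a constant times \<open>(3 powr (r / 2)) ^ d\<close>
  with \<open>d\<close> the distance, so the weight enumerator gives the same inner sum for each of
  the \<open>2 ^ n\<close> words \<open>x1\<close>.\<close>

lemma tilted_sum:
  fixes r a :: real
  assumes "0 < a"
  shows "(\<Sum>x1\<in>words n. \<Sum>x2\<in>words n. (a * 3 powr (hamming_dist n x1 x2 / 2)) powr r) / 2 ^ (2 * n)
    = a powr r * ((1 + 3 powr (r / 2)) / 2) ^ n"
proof -
  have "(a * 3 powr (real d / 2)) powr r = a powr r * (3 powr (r / 2)) ^ d" for d
    using assms by (simp add: powr_mult powr_powr powr_realpow [symmetric] mult.commute)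
  then have "(\<Sum>x1\<in>words n. \<Sum>x2\<in>words n. (a * 3 powr (hamming_dist n x1 x2 / 2)) powr r) =
      (\<Sum>x1\<in>words n. a powr r * (1 + 3 powr (r / 2)) ^ n)"
    by (intro sum.cong) (simp_all add: sum_distrib_left [symmetric] hamming_dist_weight_enumerator)
  also have "\<dots> = 2 ^ n * (a powr r * (1 + 3 powr (r / 2)) ^ n)"
    by (simp add: card_words)
  finally show ?thesis
    by (simp add: power_divide mult_2 power_add)
qed

lemma avg_misid_prob_bounds:
  assumes "0 \<le> B"
    and "\<And>U V. U \<in> coalitions M \<Longrightarrow> V \<in> strategies n \<Longrightarrow> misid_prob n U C V \<le> B"
  shows "0 \<le> avg_misid_prob n M C" "avg_misid_prob n M C \<le> B"
proof -
  let ?S = "\<lambda>U. SUP V\<in>strategies n. misid_prob n U C V"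
  \<comment> \<open>Handing over the first copy is always allowed. This makes the set of strategies
    nonempty, as the real supremum requires, and supplies a value for the lower bound.\<close>
  have V0: "(\<lambda>x1 x2. return_pmf x1) \<in> strategies n"
    by (auto simp: strategies_def envelope_def)
  have "0 \<le> ?S U" "?S U \<le> B" if "U \<in> coalitions M" for U
  proof -
    show "?S U \<le> B"
      using V0 assms(2)[OF that] by (intro cSUP_least) auto
    show "0 \<le> ?S U"
      by (rule cSUP_upper2[OF _ V0 misid_prob_nonneg])
        (use assms(2)[OF that] in \<open>auto intro!: bdd_aboveI2\<close>)
  qed
  then have "0 \<le> (\<Sum>U\<in>coalitions M. ?S U)" "(\<Sum>U\<in>coalitions M. ?S U) \<le> card (coalitions M) * B"
    by (auto intro: sum_nonneg sum_bounded_above)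
  moreover have "card (coalitions M) = M choose 2"
    unfolding coalitions_def using n_subsets[of "{1..M}" 2] by simp
  \<comment> \<open>If \<open>M choose 2\<close> is 0, the quotient is 0 by convention and
    \<open>0 \<le> B\<close> covers this case.\<close>
  ultimately show "0 \<le> avg_misid_prob n M C" "avg_misid_prob n M C \<le> B"
    using assms(1) by (auto simp: avg_misid_prob_def divide_le_eq mult.commute)
qed

text \<open>At \<open>r = 0\<close> the expression is 1 and its logarithmic derivative is
  \<open>(R - (1 - H(1/4))) ln 2\<close>.\<close>

lemma tilted_base_less_1:
  assumes "R < 1 - binary_entropy (1 / 4)"
  shows "\<exists>r. 0 < r \<and> r \<le> 1 \<and> (2 powr R * (2 / 3)) powr r * ((1 + 3 powr (r / 2)) / 2) < 1"
proof -
  define a :: real where "a = 2 powr R * (2 / 3)"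
  have a: "a > 0" by (simp add: a_def)
  define h where "h r = a powr r * ((1 + 3 powr (r / 2)) / 2)" for r :: real
  have "(h has_real_derivative ln a + ln 3 / 4) (at 0)"
    unfolding h_def using a by (auto intro!: derivative_eq_intros)
  moreover have "ln a + ln 3 / 4 < 0"
  proof -
    have "binary_entropy (1 / 4) = 2 - 3 / 4 * log 2 3"
      using log_nat_power[of 2 2 2] by (simp add: binary_entropy_def log_divide field_simps)
    then have "R < 3 / 4 * (ln 3 / ln 2) - 1"
      using assms by (simp add: log_def)
    then have "R * ln 2 < 3 / 4 * ln 3 - ln 2"
      by (simp add: field_simps)
    moreover have "ln a = R * ln 2 + (ln 2 - ln 3)"
      by (simp add: a_def ln_mult ln_powr ln_div)
    ultimately show ?thesis by simp
  qed
  ultimately obtain d where d: "d > 0" "\<And>r. 0 < r \<Longrightarrow> r < d \<Longrightarrow> h (0 + r) < h 0"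
    using has_real_derivative_neg_dec_right[of h _ 0 UNIV] by auto
  have "h 0 = 1" using a by (simp add: h_def)
  \<comment> \<open>The witness stays inside the interval where \<open>h\<close> is below
    \<open>h 0\<close> and respects \<open>r \<le> 1\<close>, which \<open>min_one_le_powr\<close>
    requires.\<close>
  with d(1) d(2)[of "min 1 (d / 2)"] show ?thesis
    unfolding h_def a_def by (intro exI[of _ "min 1 (d / 2)"]) auto
qed

section \<open>Exponential decay below the critical rate\<close>

theorem theorem4:
  fixes R :: real
  assumes "0 < R" and "R < 1 - binary_entropy (1 / 4)"
  shows "\<exists>C :: nat \<Rightarrow> fp_code.
     (\<forall>n. fingerprinting_code n (nat \<lfloor>2 powr (real n * R)\<rfloor>) (C n) \<and>
          MD_decoding n (nat \<lfloor>2 powr (real n * R)\<rfloor>) (C n)) \<and>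
     (\<exists>\<epsilon>>0. (\<lambda>n. avg_misid_prob n (nat \<lfloor>2 powr (real n * R)\<rfloor>) (C n))
              \<in> O(\<lambda>n. 2 powr (- \<epsilon> * real n)))"
proof -
  define M where "M n = nat \<lfloor>2 powr (real n * R)\<rfloor>" for n
  \<comment> \<open>A positive rate guarantees a user for every \<open>n\<close>, so that the
    decoder has a value to return.\<close>
  have M_ge: "M n \<ge> 1" for n
    using assms(1) by (simp add: M_def le_nat_iff le_floor_iff ge_one_powr_ge_zero)
  have M_le: "real (M n) \<le> 2 powr (real n * R)" for n
    by (simp add: M_def)
  obtain r where r: "0 < r" "r \<le> 1"
    and less: "(2 powr R * (2 / 3)) powr r * ((1 + 3 powr (r / 2)) / 2) < (1 :: real)"
    using tilted_base_less_1[OF assms(2)] by blast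
  define \<theta> :: real where "\<theta> = (2 powr R * (2 / 3)) powr r * ((1 + 3 powr (r / 2)) / 2)"
  have \<theta>: "0 < \<theta>" "\<theta> < 1"
    using less by (auto simp: \<theta>_def add_pos_pos)

  have misid: "misid_prob n U (random_code n (M n)) V \<le> \<theta> ^ n"
    if "U \<in> coalitions (M n)" "V \<in> strategies n" for n U V
  proof -
    \<comment> \<open>The part of the union bound that does not depend on the distance of the guilty
      fingerprints.\<close>
    define a where "a = real (M n) * (4 / 3) ^ n / 2 ^ n"
    have a: "a > 0" using M_ge[of n] by (simp add: a_def)
    have "misid_prob n U (random_code n (M n)) V \<le> (\<Sum>x1\<in>words n. \<Sum>x2\<in>words n.
        min 1 (a * 3 powr (hamming_dist n x1 x2 / 2))) / 2 ^ (2 * n)"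
      using misid_prob_random_code_le[OF that] by (simp add: a_def mult_ac)
    also have "\<dots> \<le> (\<Sum>x1\<in>words n. \<Sum>x2\<in>words n.
        (a * 3 powr (hamming_dist n x1 x2 / 2)) powr r) / 2 ^ (2 * n)"
      using a r by (intro divide_right_mono sum_mono min_one_le_powr) auto
    also have "\<dots> = a powr r * ((1 + 3 powr (r / 2)) / 2) ^ n"
      using a by (rule tilted_sum)
    \<comment> \<open>Replacing \<open>M n\<close> by \<open>2 powr (real n * R)\<close> makes the
      base an exact \<open>n\<close>-th power; 2/3 is (4/3)/2.\<close>
    also have "\<dots> \<le> ((2 powr R * (2 / 3)) ^ n) powr r * ((1 + 3 powr (r / 2)) / 2) ^ n"
    proof (intro mult_right_mono powr_mono2)
      have "a \<le> 2 powr (real n * R) * (4 / 3) ^ n / 2 ^ n"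
        unfolding a_def by (intro divide_right_mono mult_right_mono M_le) auto
      also have "\<dots> = (2 powr R) ^ n * ((4 / 3) / 2) ^ n"
        by (simp only: power_divide powr_power mult.commute[of R]) simp
      also have "\<dots> = (2 powr R * (2 / 3)) ^ n"
        unfolding power_mult_distrib by simp
      finally show "a \<le> (2 powr R * (2 / 3)) ^ n" .
    qed (use a r in \<open>auto simp: add_nonneg_nonneg\<close>)
    also have "((2 powr R * (2 / 3)) ^ n) powr r = ((2 powr R * (2 / 3)) powr r) ^ n"
      by (simp add: powr_realpow [symmetric] powr_powr mult.commute)
    finally show ?thesis
      by (simp only: \<theta>_def power_mult_distrib)
  qed

  \<comment> \<open>Chosen so that \<open>2 powr (- \<epsilon>)\<close> equals
    \<open>\<theta>\<close>; positive because \<open>\<theta> < 1\<close>.\<close>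
  define \<epsilon> where "\<epsilon> = - log 2 \<theta>"
  have "\<epsilon> > 0" using \<theta> by (simp add: \<epsilon>_def)
  have "2 powr (- \<epsilon> * real n) = \<theta> ^ n" for n
    using \<theta> by (simp add: \<epsilon>_def powr_powr [symmetric] powr_realpow)
  moreover have "norm (avg_misid_prob n (M n) (random_code n (M n))) \<le> 1 * norm (\<theta> ^ n)" for n
    using avg_misid_prob_bounds[of "\<theta> ^ n" "M n" n, OF _ misid] \<theta> by simp
  ultimately have "(\<lambda>n. avg_misid_prob n (M n) (random_code n (M n))) \<in> O(\<lambda>n. 2 powr (- \<epsilon> * real n))"
    by (intro bigoI[where c = 1] always_eventually) simp
  with \<open>\<epsilon> > 0\<close> show ?thesis
    using fingerprinting_random_code[OF M_ge] MD_decoding_random_code[OF M_ge] unfolding M_def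
    by (intro exI[of _ "\<lambda>n. random_code n (nat \<lfloor>2 powr (real n * R)\<rfloor>)"]) blast
qed

end
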